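(* For all positive integers $n,k$ and all $0\le i\le n$, $$P_{k,n}^{(i)}=\left(\frac{|\mathcal{IS}_{n-i}|}{|\mathcal{IS}_n|}\right)^k\cdot\left([n]_i\right)^{k-1}\cdot P_{k,n-i}^{(0)}.$$
   Context: For $m\ge0$, $\mathcal{IS}_m$ is the symmetric inverse semigroup of all partial injective maps from $\{1,\dots,m\}$ to itself, under composition of partial maps, with products read left to right; $\mathcal{IS}_0=\{0\}$ has one element (so $P_{k,0}^{(0)}=1$). The rank of $\alpha\in\mathcal{IS}_m$ is $|\operatorname{dom}(\alpha)|$. Let $x_1,\dots,x_k$ be chosen independently and uniformly at random from $\mathcal{IS}_m$. For $0\le i\le m$, $P_{k,m}^{(i)}$ is the probability that the product $x_1x_2\cdots x_k$ equals a fixed element of $\mathcal{IS}_m$ of rank $i$; this probability does not depend on the choice of the element of rank $i$. $[x]_i=x(x-1)\cdots(x-i+1)$ is the decreasing factorial, $[x]_0=1$. *)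

theory Defs
  imports "HOL-Probability.Probability" "HOL-Combinatorics.Permutations"
begin

definition sym_inv :: "nat \<Rightarrow> (nat \<rightharpoonup> nat) set" where
  "sym_inv m = {f. dom f \<subseteq> {1..m} \<and> ran f \<subseteq> {1..m} \<and> inj_on f (dom f)}"

definition map_rank :: "(nat \<rightharpoonup> nat) \<Rightarrow> nat" where
  "map_rank f = card (dom f)"

text \<open>Products are read left to right: in \<open>pmul f g\<close> the map \<open>f\<close> is applied first.\<close>

definition pmul :: "(nat \<rightharpoonup> nat) \<Rightarrow> (nat \<rightharpoonup> nat) \<Rightarrow> (nat \<rightharpoonup> nat)" where
  "pmul f g = g \<circ>\<^sub>m f"

text \<open>The product of a list of elements of \<open>sym_inv m\<close>; the starting value is the identity of
  \<open>{1..m}\<close>.\<close>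

definition list_product :: "nat \<Rightarrow> (nat \<rightharpoonup> nat) list \<Rightarrow> (nat \<rightharpoonup> nat)" where
  "list_product m xs = foldl pmul (Some |` {1..m}) xs"

text \<open>The probability that \<open>x\<^sub>1 \<cdots> x\<^sub>k = \<alpha>\<close> for independent, uniformly distributed
  \<open>x\<^sub>1, \<dots>, x\<^sub>k\<close> in \<open>sym_inv m\<close>.\<close>

definition prob_product_eq :: "nat \<Rightarrow> nat \<Rightarrow> (nat \<rightharpoonup> nat) \<Rightarrow> real" where
  "prob_product_eq k m \<alpha> =
     measure_pmf.prob (replicate_pmf k (pmf_of_set (sym_inv m))) {xs. list_product m xs = \<alpha>}"

text \<open>The same probability for a fixed element of rank \<open>i\<close>. For \<open>k > 0\<close> and \<open>i \<le> m\<close> the choice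
  of that element is immaterial, see \<open>prob_product_eq_rank\<close> and \<open>ex_sym_inv_rank\<close> below.\<close>

definition rank_prob :: "nat \<Rightarrow> nat \<Rightarrow> nat \<Rightarrow> real" where
  "rank_prob k m i = prob_product_eq k m (SOME \<alpha>. \<alpha> \<in> sym_inv m \<and> map_rank \<alpha> = i)"

definition falling_fact :: "real \<Rightarrow> nat \<Rightarrow> real" where
  "falling_fact x i = (\<Prod>j<i. x - real j)"

lemma ex_sym_inv_rank:
  assumes "i \<le> m"
  shows "\<exists>\<alpha>. \<alpha> \<in> sym_inv m \<and> map_rank \<alpha> = i"
proof (intro exI conjI)
  have d: "dom (Some |` {1..i}) = {1..i}" by (auto simp: dom_def restrict_map_def)
  show "Some |` {1..i} \<in> sym_inv m"
    unfolding sym_inv_def using assms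
    by (auto simp: dom_def ran_def restrict_map_def inj_on_def split: if_splits)
  show "map_rank (Some |` {1..i}) = i" by (simp add: map_rank_def d)
qed

lemma finite_sym_inv: "finite (sym_inv m)"
proof -
  have "sym_inv m \<subseteq> (\<Union>A\<in>Pow {1..m}. {f. dom f = A \<and> ran f \<subseteq> {1..m}})"
    by (auto simp: sym_inv_def)
  moreover have "finite (\<Union>A\<in>Pow {1..m}. {f :: nat \<rightharpoonup> nat. dom f = A \<and> ran f \<subseteq> {1..m}})"
    by (intro finite_UN_I finite_set_of_finite_maps) (auto intro: finite_subset)
  ultimately show ?thesis by (rule finite_subset)
qed

lemma sym_inv_nonempty: "sym_inv m \<noteq> {}"
  using ex_sym_inv_rank[of 0 m] by auto

lemma sym_inv_comp_perm:
  assumes "s permutes {1..m}" "f \<in> sym_inv m"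
  shows "f \<circ> s \<in> sym_inv m"
proof -
  have "dom (f \<circ> s) \<subseteq> {1..m}"
  proof
    fix x assume "x \<in> dom (f \<circ> s)"
    then have "s x \<in> dom f" by auto
    then have "s x \<in> {1..m}" using assms(2) by (auto simp: sym_inv_def)
    then show "x \<in> {1..m}" using permutes_in_image[OF assms(1)] by blast
  qed
  moreover have "ran (f \<circ> s) \<subseteq> {1..m}" using assms(2) by (auto simp: sym_inv_def ran_def)
  moreover have "inj_on (f \<circ> s) (dom (f \<circ> s))"
    using assms(2) permutes_inj[OF assms(1)]
    by (intro comp_inj_on) (auto simp: sym_inv_def inj_on_def dom_def)
  ultimately show ?thesis by (simp add: sym_inv_def)
qed

lemma sym_inv_perm_comp:
  assumes "t permutes {1..m}" "f \<in> sym_inv m"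
  shows "map_option t \<circ> f \<in> sym_inv m"
proof -
  have d: "dom (map_option t \<circ> f) = dom f" by (auto simp: dom_def)
  have "ran (map_option t \<circ> f) \<subseteq> {1..m}"
  proof
    fix y assume "y \<in> ran (map_option t \<circ> f)"
    then obtain z where "z \<in> ran f" "y = t z" by (auto simp: ran_def)
    then show "y \<in> {1..m}"
      using assms(2) permutes_in_image[OF assms(1), of z] by (auto simp: sym_inv_def)
  qed
  moreover have "inj_on (map_option t \<circ> f) (dom f)"
    using assms(2) option.inj_map[OF permutes_inj[OF assms(1)]]
    by (intro comp_inj_on) (auto simp: sym_inv_def inj_on_def)
  ultimately show ?thesis using assms(2) by (simp add: sym_inv_def d)
qed

lemma map_pmf_sym_inv_left:
  assumes "s permutes {1..m}"
  shows "map_pmf (\<lambda>f. f \<circ> s) (pmf_of_set (sym_inv m)) = pmf_of_set (sym_inv m)"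
proof -
  have inj: "inj_on (\<lambda>f. f \<circ> s) (sym_inv m)"
    by (intro inj_onI) (metis assms comp_assoc comp_id permutes_inv_o(1))
  have "(\<lambda>f. f \<circ> s) ` sym_inv m = sym_inv m"
    using endo_inj_surj[OF finite_sym_inv _ inj] sym_inv_comp_perm[OF assms] by blast
  then show ?thesis
    using map_pmf_of_set_inj[OF inj sym_inv_nonempty finite_sym_inv] by simp
qed

lemma map_pmf_sym_inv_right:
  assumes "t permutes {1..m}"
  shows "map_pmf (\<lambda>f. map_option t \<circ> f) (pmf_of_set (sym_inv m)) = pmf_of_set (sym_inv m)"
proof -
  have inj: "inj_on (\<lambda>f. map_option t \<circ> f) (sym_inv m)"
    using option.inj_map[OF permutes_inj[OF assms]] by (auto simp: inj_on_def fun_eq_iff)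
  have "(\<lambda>f. map_option t \<circ> f) ` sym_inv m = sym_inv m"
    using endo_inj_surj[OF finite_sym_inv _ inj] sym_inv_perm_comp[OF assms] by blast
  then show ?thesis
    using map_pmf_of_set_inj[OF inj sym_inv_nonempty finite_sym_inv] by simp
qed

lemma pmul_perm_left: "pmul f g \<circ> s = pmul (f \<circ> s) g"
  by (auto simp: pmul_def map_comp_def fun_eq_iff)

lemma pmul_perm_right: "map_option t \<circ> pmul f g = pmul f (map_option t \<circ> g)"
  by (auto simp: pmul_def map_comp_def fun_eq_iff split: option.splits)

lemma foldl_pmul_perm_left: "foldl pmul f xs \<circ> s = foldl pmul (f \<circ> s) xs"
  by (induction xs arbitrary: f) (simp_all add: pmul_perm_left)

lemma pmul_one_left:
  assumes "f \<in> sym_inv m"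
  shows "pmul (Some |` {1..m}) f = f"
proof
  fix x
  have "x \<notin> {1..m} \<Longrightarrow> f x = None" using assms by (auto simp: sym_inv_def)
  then show "pmul (Some |` {1..m}) f x = f x"
    by (auto simp: pmul_def map_comp_def restrict_map_def)
qed

abbreviation product_pmf :: "nat \<Rightarrow> nat \<Rightarrow> (nat \<rightharpoonup> nat) pmf" where
  "product_pmf k m \<equiv> map_pmf (list_product m) (replicate_pmf k (pmf_of_set (sym_inv m)))"

lemma prob_product_eq_pmf: "prob_product_eq k m \<alpha> = pmf (product_pmf k m) \<alpha>"
  by (simp add: prob_product_eq_def pmf_map vimage_def)

lemma product_pmf_left:
  assumes "s permutes {1..m}" "0 < k"
  shows "map_pmf (\<lambda>f. f \<circ> s) (product_pmf k m) = product_pmf k m"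
proof -
  obtain l where k: "k = Suc l" using assms(2) gr0_conv_Suc by blast
  let ?u = "pmf_of_set (sym_inv m)"
  have Suc: "product_pmf (Suc l) m
      = bind_pmf ?u (\<lambda>x. map_pmf (foldl pmul x) (replicate_pmf l ?u))"
    unfolding map_pmf_def replicate_pmf.simps bind_assoc_pmf bind_return_pmf
    by (intro bind_pmf_cong refl)
       (auto simp: list_product_def pmul_one_left finite_sym_inv sym_inv_nonempty
         simp del: One_nat_def)
  have "map_pmf (\<lambda>f. f \<circ> s) (product_pmf (Suc l) m)
      = bind_pmf (map_pmf (\<lambda>f. f \<circ> s) ?u) (\<lambda>x. map_pmf (foldl pmul x) (replicate_pmf l ?u))"
    by (simp only: Suc map_bind_pmf pmf.map_comp o_def[of "\<lambda>f. f \<circ> s"] bind_map_pmf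
        foldl_pmul_perm_left)
  then show ?thesis by (simp only: k map_pmf_sym_inv_left[OF assms(1)] Suc)
qed

lemma product_pmf_right:
  assumes "t permutes {1..m}" "0 < k"
  shows "map_pmf (\<lambda>f. map_option t \<circ> f) (product_pmf k m) = product_pmf k m"
proof -
  obtain l where k: "k = l + 1" using assms(2) gr0_conv_Suc by force
  let ?u = "pmf_of_set (sym_inv m)"
  have snoc: "product_pmf (l + 1) m
      = bind_pmf (replicate_pmf l ?u) (\<lambda>xs. map_pmf (pmul (list_product m xs)) ?u)"
    unfolding replicate_pmf_distrib replicate_pmf_1
    by (simp add: map_pmf_def bind_assoc_pmf bind_return_pmf list_product_def)
  have "map_pmf (\<lambda>f. map_option t \<circ> f) (product_pmf (l + 1) m)
      = bind_pmf (replicate_pmf l ?u)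
          (\<lambda>xs. map_pmf (pmul (list_product m xs)) (map_pmf (\<lambda>f. map_option t \<circ> f) ?u))"
    unfolding snoc map_bind_pmf pmf.map_comp
    by (intro bind_pmf_cong map_pmf_cong refl) (simp add: pmul_perm_right)
  then show ?thesis by (simp only: k map_pmf_sym_inv_right[OF assms(1)] snoc)
qed

lemma bij_betw_extend_permutes:
  assumes "finite S" "A \<subseteq> S" "B \<subseteq> S" "bij_betw f A B"
  obtains p where "p permutes S" "\<And>x. x \<in> A \<Longrightarrow> p x = f x"
proof -
  have "card (S - A) = card (S - B)"
    using assms bij_betw_same_card[OF assms(4)] by (simp add: card_Diff_subset finite_subset)
  then obtain h where h: "bij_betw h (S - A) (S - B)"
    using assms(1) finite_same_card_bij[of "S - A" "S - B"] by auto
  define p where "p x = (if x \<in> A then f x else if x \<in> S then h x else x)" for x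
  have "bij_betw p A B" using assms(4) by (subst bij_betw_cong[of A p f]) (auto simp: p_def)
  moreover have "bij_betw p (S - A) (S - B)"
    using h by (subst bij_betw_cong[of "S - A" p h]) (auto simp: p_def)
  ultimately have "bij_betw p (A \<union> (S - A)) (B \<union> (S - B))"
    by (rule bij_betw_combine) auto
  then have "bij_betw p S S" using assms(2,3) by (simp add: Un_absorb1)
  then have "p permutes S" using assms(2) by (intro bij_imp_permutes) (auto simp: p_def)
  then show ?thesis using that[of p] by (simp add: p_def)
qed

lemma sym_inv_same_rank:
  assumes "\<alpha> \<in> sym_inv m" "\<beta> \<in> sym_inv m" "map_rank \<alpha> = map_rank \<beta>"
  obtains s t where "s permutes {1..m}" "t permutes {1..m}"
    "\<beta> = map_option t \<circ> (\<alpha> \<circ> s)"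
proof -
  have da: "dom \<alpha> \<subseteq> {1..m}" and db: "dom \<beta> \<subseteq> {1..m}"
    using assms by (auto simp: sym_inv_def)
  obtain g where g: "bij_betw g (dom \<beta>) (dom \<alpha>)"
    using finite_same_card_bij[of "dom \<beta>" "dom \<alpha>"] assms(3) da db
    by (auto simp: map_rank_def intro: finite_subset)
  obtain s where s: "s permutes {1..m}" and sg: "\<And>x. x \<in> dom \<beta> \<Longrightarrow> s x = g x"
    using bij_betw_extend_permutes[OF _ db da g] by auto
  have s_img: "s ` dom \<beta> = dom \<alpha>"
    using g sg by (simp add: bij_betw_def)
  have s_dom: "s x \<in> dom \<alpha> \<longleftrightarrow> x \<in> dom \<beta>" for x
    unfolding s_img[symmetric] by (rule inj_image_mem_iff[OF permutes_inj[OF s]])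
  have "inj_on (\<lambda>x. the (f x)) (dom f)" if "f \<in> sym_inv m" for f
  proof (rule inj_onI)
    fix x y assume xy: "x \<in> dom f" "y \<in> dom f" "the (f x) = the (f y)"
    then have "f x = f y" by (auto simp: dom_def)
    then show "x = y" using xy that by (auto simp: sym_inv_def dest: inj_onD)
  qed
  moreover have "(\<lambda>x. the (f x)) ` dom f = ran f" for f :: "nat \<rightharpoonup> nat"
    by (auto simp: ran_def dom_def image_def)
  ultimately have bij: "bij_betw (\<lambda>x. the (f x)) (dom f) (ran f)" if "f \<in> sym_inv m" for f
    using that by (simp add: bij_betw_def)
  have comp: "\<alpha> \<circ> s \<in> sym_inv m" by (rule sym_inv_comp_perm[OF s assms(1)])
  have dom_comp: "dom (\<alpha> \<circ> s) = dom \<beta>" using s_dom by (auto simp: dom_def)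
  let ?v = "inv_into (dom \<beta>) (\<lambda>x. the ((\<alpha> \<circ> s) x))"
  have bij_as: "bij_betw (\<lambda>x. the ((\<alpha> \<circ> s) x)) (dom \<beta>) (ran (\<alpha> \<circ> s))"
    using bij[OF comp] by (simp add: dom_comp)
  have bv: "bij_betw ((\<lambda>x. the (\<beta> x)) \<circ> ?v) (ran (\<alpha> \<circ> s)) (ran \<beta>)"
    by (rule bij_betw_trans[OF bij_betw_inv_into[OF bij_as] bij[OF assms(2)]])
  have rans: "ran (\<alpha> \<circ> s) \<subseteq> {1..m}" "ran \<beta> \<subseteq> {1..m}"
    using comp assms(2) by (auto simp: sym_inv_def)
  obtain t where t: "t permutes {1..m}"
    and tv: "\<And>y. y \<in> ran (\<alpha> \<circ> s) \<Longrightarrow> t y = ((\<lambda>x. the (\<beta> x)) \<circ> ?v) y"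
    using bij_betw_extend_permutes[OF finite_atLeastAtMost rans bv] by blast
  have "\<beta> x = map_option t ((\<alpha> \<circ> s) x)" for x
  proof (cases "x \<in> dom \<beta>")
    case True
    then obtain y where y: "(\<alpha> \<circ> s) x = Some y" using dom_comp by blast
    then have "?v y = x"
      using bij_betw_inv_into_left[OF bij_as True] by simp
    moreover have "y \<in> ran (\<alpha> \<circ> s)" using y by (rule ranI)
    ultimately show ?thesis using tv y True by auto
  next
    case False
    then have "(\<alpha> \<circ> s) x = None" using dom_comp by blast
    then show ?thesis using False by auto
  qed
  then have "\<beta> = map_option t \<circ> (\<alpha> \<circ> s)" by (simp add: fun_eq_iff)
  with s t show ?thesis by (rule that)
qed

lemma prob_product_eq_same_rank:
  assumes "0 < k" "\<alpha> \<in> sym_inv m" "\<beta> \<in> sym_inv m" "map_rank \<alpha> = map_rank \<beta>"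
  shows "prob_product_eq k m \<alpha> = prob_product_eq k m \<beta>"
proof -
  obtain s t where s: "s permutes {1..m}" and t: "t permutes {1..m}"
    and b: "\<beta> = map_option t \<circ> (\<alpha> \<circ> s)"
    by (rule sym_inv_same_rank[OF assms(2-4)])
  have inj_s: "inj (\<lambda>f :: nat \<rightharpoonup> nat. f \<circ> s)"
    by (intro injI) (metis s comp_assoc comp_id permutes_inv_o(1))
  have inj_t: "inj (\<lambda>f :: nat \<rightharpoonup> nat. map_option t \<circ> f)"
    using option.inj_map[OF permutes_inj[OF t]] by (auto simp: inj_on_def fun_eq_iff)
  have "pmf (product_pmf k m) \<alpha> = pmf (map_pmf (\<lambda>f. f \<circ> s) (product_pmf k m)) (\<alpha> \<circ> s)"
    by (rule pmf_map_inj'[OF inj_s, symmetric])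
  also have "\<dots> = pmf (product_pmf k m) (\<alpha> \<circ> s)"
    by (simp only: product_pmf_left[OF s assms(1)])
  also have "\<dots> = pmf (map_pmf (\<lambda>f. map_option t \<circ> f) (product_pmf k m)) \<beta>"
    unfolding b by (rule pmf_map_inj'[OF inj_t, symmetric])
  also have "\<dots> = pmf (product_pmf k m) \<beta>"
    by (simp only: product_pmf_right[OF t assms(1)])
  finally show ?thesis by (simp only: prob_product_eq_pmf)
qed

lemma prob_product_eq_rank:
  assumes "0 < k" "\<alpha> \<in> sym_inv m"
  shows "prob_product_eq k m \<alpha> = rank_prob k m (map_rank \<alpha>)"
proof -
  define \<beta> where "\<beta> = (SOME \<beta>. \<beta> \<in> sym_inv m \<and> map_rank \<beta> = map_rank \<alpha>)"
  have \<beta>: "\<beta> \<in> sym_inv m \<and> map_rank \<beta> = map_rank \<alpha>"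
    unfolding \<beta>_def by (rule someI[of _ \<alpha>]) (rule conjI[OF assms(2) refl])
  have "prob_product_eq k m \<alpha> = prob_product_eq k m \<beta>"
    by (rule prob_product_eq_same_rank[OF assms conjunct1[OF \<beta>] conjunct2[OF \<beta>, symmetric]])
  then show ?thesis
    unfolding rank_prob_def \<beta>_def .
qed

end

theory Submission
  imports Defs
begin

text \<open>
  Write \<open>n = m + i\<close>, let \<open>T = {m + 1..m + i}\<close>, and use as the fixed element of rank \<open>i\<close> the
  identity of \<open>T\<close>, the set of top points. If \<open>x\<^sub>1 \<cdots> x\<^sub>k\<close> is this element, every partial product \<open>x\<^sub>1 \<cdots> x\<^sub>j\<close> is
  defined on \<open>T\<close> and restricts there to an injection \<open>\<phi>\<^sub>j : T \<rightarrow> {1..n}\<close>. The injections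
  \<open>\<phi>\<^sub>1, \<dots>, \<phi>\<^bsub>k-1\<^esub>\<close> are arbitrary, \<open>[n]\<^sub>i\<close> choices each, while \<open>\<phi>\<^sub>k\<close> must be the inclusion. Off the
  images of \<open>T\<close>, what remains of the \<open>x\<^sub>j\<close> is, after relabelling, a sequence of \<open>k\<close> elements of
  \<open>sym_inv m\<close> with empty product. Counting the pairs and dividing by \<open>|sym_inv n| ^ k\<close> gives
  the formula.

  The relabelling is done one factor at a time. Extend each injection \<open>\<phi>\<close> to a permutation
  \<open>p\<^sub>\<phi>\<close> of \<open>{1..n}\<close>. An \<open>x\<close> in \<open>sym_inv n\<close> that is defined on all of \<open>T\<close> is, in a unique way, some
  \<open>z\<close> in \<open>sym_inv m\<close> enlarged by the identity of \<open>T\<close>, followed by \<open>p\<^sub>\<phi>\<close>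
  (\<open>sum_over_defined_on_top\<close>). The permutation is absorbed by the next uniform factor
  (\<open>walk_prob_perm\<close>), so the sum over \<open>\<phi>\<close> contributes a factor \<open>[n]\<^sub>i\<close>; only the last factor has
  no successor, and there \<open>\<phi>\<close> is forced. Induction on \<open>k\<close> (\<open>walk_prob_pad\<close>) needs an
  arbitrary starting point for the product in place of the identity.
\<close>

section \<open>Random products with an arbitrary starting element\<close>

definition walk_prob :: "nat \<Rightarrow> nat \<Rightarrow> (nat \<rightharpoonup> nat) \<Rightarrow> (nat \<rightharpoonup> nat) \<Rightarrow> real" where
  "walk_prob m k g \<alpha> =
     pmf (map_pmf (foldl pmul g) (replicate_pmf k (pmf_of_set (sym_inv m)))) \<alpha>"

lemma walk_prob_0: "walk_prob m 0 g \<alpha> = of_bool (g = \<alpha>)"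
  by (simp add: walk_prob_def)

lemma walk_prob_Suc:
  "walk_prob m (Suc k) g \<alpha>
     = (\<Sum>x\<in>sym_inv m. walk_prob m k (pmul g x) \<alpha>) / real (card (sym_inv m))"
proof -
  have "map_pmf (foldl pmul g) (replicate_pmf (Suc k) (pmf_of_set (sym_inv m)))
      = bind_pmf (pmf_of_set (sym_inv m))
          (\<lambda>x. map_pmf (foldl pmul (pmul g x)) (replicate_pmf k (pmf_of_set (sym_inv m))))"
    by (simp add: map_pmf_def bind_assoc_pmf bind_return_pmf)
  then show ?thesis
    by (simp add: walk_prob_def pmf_bind_pmf_of_set sym_inv_nonempty finite_sym_inv)
qed

lemma prob_product_eq_walk_prob:
  "prob_product_eq k m \<alpha> = walk_prob m k (Some |` {1..m}) \<alpha>"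
proof -
  have "list_product m = foldl pmul (Some |` {1..m})"
    by (rule ext) (simp add: list_product_def)
  then show ?thesis by (simp add: prob_product_eq_pmf walk_prob_def)
qed

lemma inj_on_comp_perm:
  assumes "p permutes S"
  shows "inj_on (\<lambda>f. f \<circ> p) A"
  by (intro inj_onI) (metis assms comp_assoc comp_id permutes_inv_o(1))

text \<open>The next factor absorbs a permutation, because \<open>(g p) x = g (p x)\<close> and \<open>p x\<close> is as uniform
  as \<open>x\<close>.\<close>

lemma walk_prob_perm:
  assumes "p permutes {1..m}"
  shows "walk_prob m (Suc k) (map_option p \<circ> g) \<alpha> = walk_prob m (Suc k) g \<alpha>"
proof -
  have inj: "inj_on (\<lambda>x. x \<circ> p) (sym_inv m)" by (rule inj_on_comp_perm[OF assms])
  have surj: "(\<lambda>x. x \<circ> p) ` sym_inv m = sym_inv m"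
    using endo_inj_surj[OF finite_sym_inv _ inj] sym_inv_comp_perm[OF assms] by blast
  have shift: "pmul (map_option p \<circ> g) x = pmul g (x \<circ> p)" for x
    by (auto simp: pmul_def map_comp_def fun_eq_iff split: option.splits)
  have "(\<Sum>x\<in>sym_inv m. walk_prob m k (pmul g (x \<circ> p)) \<alpha>)
      = (\<Sum>x\<in>(\<lambda>x. x \<circ> p) ` sym_inv m. walk_prob m k (pmul g x) \<alpha>)"
    by (simp add: sum.reindex[OF inj])
  then show ?thesis by (simp add: walk_prob_Suc shift surj)
qed

text \<open>Domains only shrink along a product.\<close>

lemma walk_prob_eq_0:
  assumes "\<not> dom \<alpha> \<subseteq> dom g"
  shows "walk_prob m k g \<alpha> = 0"
  using assms
proof (induction k arbitrary: g)
  case 0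
  then show ?case by (auto simp: walk_prob_0)
next
  case (Suc k)
  have "dom (pmul g x) \<subseteq> dom g" for x
    by (auto simp: pmul_def map_comp_def split: option.splits)
  then have "\<not> dom \<alpha> \<subseteq> dom (pmul g x)" for x using Suc.prems by blast
  then show ?case by (simp add: walk_prob_Suc Suc.IH)
qed

section \<open>Splitting off the action on the top points\<close>

definition pad :: "nat \<Rightarrow> nat \<Rightarrow> (nat \<rightharpoonup> nat) \<Rightarrow> (nat \<rightharpoonup> nat)" where
  "pad m i z = (\<lambda>x. if x \<in> {m + 1..m + i} then Some x else z x)"

lemma pad_eq_iff:
  assumes "g \<in> sym_inv m" "h \<in> sym_inv m"
  shows "pad m i g = pad m i h \<longleftrightarrow> g = h"
proof
  assume eq: "pad m i g = pad m i h"
  show "g = h"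
  proof
    fix x
    show "g x = h x"
    proof (cases "x \<in> {m + 1..m + i}")
      case True
      then have "x \<notin> dom g" "x \<notin> dom h" using assms by (auto simp: sym_inv_def)
      then show ?thesis by (simp add: domIff)
    next
      case False
      then show ?thesis using fun_cong[OF eq, of x] by (simp add: pad_def split: if_splits)
    qed
  qed
qed simp

lemma pad_in_sym_inv:
  assumes "z \<in> sym_inv m"
  shows "pad m i z \<in> sym_inv (m + i)"
proof -
  have z: "dom z \<subseteq> {1..m}" "ran z \<subseteq> {1..m}" "inj_on z (dom z)"
    using assms by (auto simp: sym_inv_def)
  have d: "x \<in> {1..m}" "y \<in> {1..m}" if "z x = Some y" for x y
    using that z by (auto intro: ranI)
  have "dom (pad m i z) \<subseteq> {1..m + i}"
    using d by (fastforce simp: pad_def dom_def split: if_splits)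
  moreover have "ran (pad m i z) \<subseteq> {1..m + i}"
    using d by (fastforce simp: pad_def ran_def split: if_splits)
  moreover have "inj_on (pad m i z) (dom (pad m i z))"
  proof (rule inj_onI)
    fix x y assume xy: "x \<in> dom (pad m i z)" "pad m i z x = pad m i z y"
    then obtain v where v: "pad m i z x = Some v" "pad m i z y = Some v" by (metis domD)
    show "x = y"
    proof (cases "v \<in> {m + 1..m + i}")
      case True
      then have "z x \<noteq> Some v" "z y \<noteq> Some v" using d(2)[of _ v] by auto
      then show ?thesis using v by (auto simp: pad_def split: if_splits)
    next
      case False
      then have "z x = Some v" "z y = Some v" using v by (auto simp: pad_def split: if_splits)
      then show ?thesis using z(3) by (metis domI inj_onD)
    qed
  qed
  ultimately show ?thesis by (simp add: sym_inv_def)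
qed

lemma pmul_in_sym_inv:
  assumes "g \<in> sym_inv m" "h \<in> sym_inv m"
  shows "pmul g h \<in> sym_inv m"
proof -
  have "inj_on (pmul g h) (dom (pmul g h))"
  proof (rule inj_onI)
    fix x y assume "x \<in> dom (pmul g h)" "pmul g h x = pmul g h y"
    then obtain u v w where *: "g x = Some u" "g y = Some v" "h u = Some w" "h v = Some w"
      by (auto simp: pmul_def map_comp_def split: option.splits)
    then have "u = v" using assms(2) by (auto simp: sym_inv_def inj_on_def dom_def)
    then show "x = y" using * assms(1) by (auto simp: sym_inv_def inj_on_def dom_def)
  qed
  moreover have "dom (pmul g h) \<subseteq> dom g" "ran (pmul g h) \<subseteq> ran h"
    by (auto simp: pmul_def map_comp_def ran_def split: option.splits)
  ultimately show ?thesis using assms by (auto simp: sym_inv_def)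
qed

lemma pmul_pad:
  assumes "g \<in> sym_inv m"
  shows "pmul (pad m i g) (map_option p \<circ> pad m i z) = map_option p \<circ> pad m i (pmul g z)"
proof
  fix x
  show "pmul (pad m i g) (map_option p \<circ> pad m i z) x = (map_option p \<circ> pad m i (pmul g z)) x"
  proof (cases "x \<in> {m + 1..m + i}")
    case True
    then show ?thesis by (simp add: pmul_def pad_def)
  next
    case False
    have "y \<notin> {m + 1..m + i}" if "g x = Some y" for y
      using assms ranI[of g x y, OF that] by (auto simp: sym_inv_def)
    then show ?thesis using False
      by (auto simp: pmul_def pad_def map_comp_def split: option.splits)
  qed
qed

text \<open>An injective \<open>x\<close> that agrees with \<open>p\<close> on the top points sends no other point into the
  image of the top points, so \<open>x\<close> followed by the inverse of \<open>p\<close> splits into the identity of the top points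
  and an element of \<open>sym_inv m\<close>.\<close>

lemma bij_betw_pad_perm:
  assumes p: "p permutes {1..m + i}"
  shows "bij_betw (\<lambda>z. map_option p \<circ> pad m i z) (sym_inv m)
           {x \<in> sym_inv (m + i). \<forall>t\<in>{m + 1..m + i}. x t = Some (p t)}"
  (is "bij_betw ?F _ ?X")
proof (rule bij_betw_imageI)
  show "inj_on ?F (sym_inv m)"
  proof (rule inj_onI)
    fix g h assume *: "g \<in> sym_inv m" "h \<in> sym_inv m" "?F g = ?F h"
    have "pad m i g x = pad m i h x" for x
      using injD[OF option.inj_map[OF permutes_inj[OF p]]] fun_cong[OF *(3), of x] by simp
    then show "g = h" using pad_eq_iff[OF *(1,2)] by blast
  qed
  show "?F ` sym_inv m = ?X"
  proof (intro equalityI subsetI)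
    fix x assume "x \<in> ?F ` sym_inv m"
    then show "x \<in> ?X"
      using sym_inv_perm_comp[OF p] pad_in_sym_inv by (auto simp: pad_def)
  next
    fix x assume "x \<in> ?X"
    then have x: "x \<in> sym_inv (m + i)" and xt: "\<And>t. t \<in> {m + 1..m + i} \<Longrightarrow> x t = Some (p t)"
      by auto
    define y where "y = map_option (inv p) \<circ> x"
    have y: "y \<in> sym_inv (m + i)"
      unfolding y_def by (rule sym_inv_perm_comp[OF permutes_inv[OF p] x])
    have yt: "y t = Some t" if "t \<in> {m + 1..m + i}" for t
      by (simp add: y_def xt[OF that] permutes_inverses(2)[OF p])
    define z where "z = y |` {1..m}"
    have y_inj: "a = b" if "y a = Some v" "y b = Some v" for a b v
      using y that by (auto simp: sym_inv_def inj_on_def dom_def)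
    have y_dom: "a \<in> {1..m + i}" "v \<in> {1..m + i}" if "y a = Some v" for a v
      using y that by (auto simp: sym_inv_def dom_def ran_def)
    have z_ran: "v \<in> {1..m}" if "a \<in> {1..m}" "y a = Some v" for a v
    proof (rule ccontr)
      assume "v \<notin> {1..m}"
      then have "v \<in> {m + 1..m + i}" using y_dom(2)[OF that(2)] by auto
      moreover from this have "a = v" using y_inj[OF that(2) yt] by blast
      ultimately show False using that(1) by auto
    qed
    have z_y: "a \<in> {1..m}" "y a = Some v" if "z a = Some v" for a v
      using that by (simp_all add: z_def restrict_map_def split: if_splits)
    have "dom z \<subseteq> {1..m}" using z_y(1) by blast
    moreover have "ran z \<subseteq> {1..m}"
    proof
      fix v assume "v \<in> ran z"
      then obtain a where "z a = Some v" by (auto simp: ran_def)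
      then show "v \<in> {1..m}" by (intro z_ran[of a v] z_y)
    qed
    moreover have "inj_on z (dom z)"
    proof (rule inj_onI)
      fix a b assume "a \<in> dom z" "z a = z b"
      then obtain v where "z a = Some v" "z b = Some v" by (metis domD)
      then show "a = b" by (intro y_inj[of a v b] z_y(2))
    qed
    ultimately have "z \<in> sym_inv m" by (simp add: sym_inv_def)
    moreover have "pad m i z = y"
    proof
      fix a
      have "a \<in> {1..m + i}" if "y a \<noteq> None" using that y_dom(1) by blast
      then show "pad m i z a = y a"
        using yt[of a] by (cases "y a") (auto simp: pad_def z_def restrict_map_def)
    qed
    moreover have "map_option p \<circ> y = x"
      by (simp add: y_def fun_eq_iff option.map_comp o_def permutes_inverses(1)[OF p] option.map_ident)
    ultimately show "x \<in> ?F ` sym_inv m" by force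
  qed
qed

definition top_injections :: "nat \<Rightarrow> nat \<Rightarrow> (nat \<Rightarrow> nat) set" where
  "top_injections m i =
     {\<phi> \<in> {m + 1..m + i} \<rightarrow>\<^sub>E {1..m + i}. inj_on \<phi> {m + 1..m + i}}"

lemma finite_top_injections: "finite (top_injections m i)"
proof -
  have "finite ({m + 1..m + i} \<rightarrow>\<^sub>E {1..m + i})" by (intro finite_PiE) auto
  then show ?thesis unfolding top_injections_def by simp
qed

lemma card_top_injections:
  "real (card (top_injections m i)) = falling_fact (real (m + i)) i"
proof -
  have "card (top_injections m i) = (\<Prod>j\<in>{0..<i}. m + i - j)"
    unfolding top_injections_def
    by (subst card_inj_on_subset_funcset) auto
  then have "real (card (top_injections m i)) = (\<Prod>j\<in>{0..<i}. real (m + i - j))" by simp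
  also have "\<dots> = (\<Prod>j\<in>{0..<i}. real (m + i) - real j)"
    by (intro prod.cong refl of_nat_diff) auto
  finally show ?thesis by (simp add: falling_fact_def atLeast0LessThan)
qed

lemma top_injection_extends_to_perm:
  assumes "\<phi> \<in> top_injections m i"
  shows "\<exists>p. p permutes {1..m + i} \<and> (\<forall>t\<in>{m + 1..m + i}. p t = \<phi> t)"
proof -
  have "bij_betw \<phi> {m + 1..m + i} (\<phi> ` {m + 1..m + i})"
    using assms by (simp add: top_injections_def bij_betw_def)
  moreover have "\<phi> ` {m + 1..m + i} \<subseteq> {1..m + i}"
    using assms unfolding top_injections_def PiE_def by blast
  moreover have "{m + 1..m + i} \<subseteq> {1..m + i}" by auto
  ultimately show ?thesis
    using bij_betw_extend_permutes[OF finite_atLeastAtMost] by metis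
qed

text \<open>Elements \<open>x\<close> defined on all top points are grouped by their restriction \<open>\<phi>\<close> to these; each
  group is parametrised by \<open>bij_betw_pad_perm\<close>. The other \<open>x\<close> contribute nothing, as the
  product with \<open>pad m i g\<close> is then undefined at some top point.\<close>

lemma sum_over_defined_on_top:
  fixes w :: "(nat \<rightharpoonup> nat) \<Rightarrow> real"
  assumes g: "g \<in> sym_inv m"
    and w0: "\<And>h. \<not> {m + 1..m + i} \<subseteq> dom h \<Longrightarrow> w h = 0"
    and p: "\<And>\<phi>. \<phi> \<in> top_injections m i \<Longrightarrow> p \<phi> permutes {1..m + i}"
    and p\<phi>: "\<And>\<phi> t. \<phi> \<in> top_injections m i \<Longrightarrow> t \<in> {m + 1..m + i} \<Longrightarrow> p \<phi> t = \<phi> t"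
  shows "(\<Sum>x\<in>sym_inv (m + i). w (pmul (pad m i g) x))
       = (\<Sum>\<phi>\<in>top_injections m i. \<Sum>z\<in>sym_inv m. w (map_option (p \<phi>) \<circ> pad m i (pmul g z)))"
proof -
  let ?T = "{m + 1..m + i}"
  let ?X = "{x \<in> sym_inv (m + i). ?T \<subseteq> dom x}"
  let ?w = "\<lambda>x. w (pmul (pad m i g) x)"
  let ?r = "\<lambda>x :: nat \<rightharpoonup> nat. \<lambda>t\<in>?T. the (x t)"
  have fin: "finite ?X" using finite_sym_inv by simp
  have "?w x = 0" if "x \<in> sym_inv (m + i) - ?X" for x
  proof -
    from that obtain t where "t \<in> ?T" "x t = None" by blast
    then have "t \<in> ?T" "t \<notin> dom (pmul (pad m i g) x)"
      by (auto simp: pmul_def pad_def map_comp_def split: if_splits)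
    then show ?thesis using w0 by blast
  qed
  then have "(\<Sum>x\<in>sym_inv (m + i). ?w x) = (\<Sum>x\<in>?X. ?w x)"
    by (intro sum.mono_neutral_right finite_sym_inv) auto
  also have "\<dots> = (\<Sum>\<phi>\<in>top_injections m i. \<Sum>x | x \<in> ?X \<and> ?r x = \<phi>. ?w x)"
  proof (rule sum.group[OF fin finite_top_injections, symmetric], rule image_subsetI)
    fix x assume "x \<in> ?X"
    then have x: "x \<in> sym_inv (m + i)" and d: "?T \<subseteq> dom x" by auto
    have val: "x t = Some (the (x t))" if "t \<in> ?T" for t using that d by auto
    have "the (x t) \<in> {1..m + i}" if "t \<in> ?T" for t
      using x ranI[of x t, OF val[OF that]] by (auto simp: sym_inv_def)
    moreover have "inj_on (?r x) ?T"
    proof (rule inj_onI)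
      fix s t assume st: "s \<in> ?T" "t \<in> ?T" "?r x s = ?r x t"
      then have "the (x s) = the (x t)" by simp
      then have "x s = x t" using val[OF st(1)] val[OF st(2)] by simp
      then show "s = t" using x st(1,2) d by (auto simp: sym_inv_def dest!: inj_onD)
    qed
    ultimately show "?r x \<in> top_injections m i" unfolding top_injections_def by auto
  qed
  also have "\<dots> = (\<Sum>\<phi>\<in>top_injections m i. \<Sum>z\<in>sym_inv m.
      w (map_option (p \<phi>) \<circ> pad m i (pmul g z)))"
  proof (rule sum.cong[OF refl])
    fix \<phi> assume \<phi>: "\<phi> \<in> top_injections m i"
    have ext: "\<phi> \<in> extensional ?T" using \<phi> by (auto simp: top_injections_def PiE_def)
    have "{x \<in> ?X. ?r x = \<phi>} = {x \<in> sym_inv (m + i). \<forall>t\<in>?T. x t = Some (p \<phi> t)}"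
    proof (intro Collect_cong iffI conjI ballI)
      fix x t assume "x \<in> ?X \<and> ?r x = \<phi>" "t \<in> ?T"
      then have "x t = Some (\<phi> t)" by force
      then show "x t = Some (p \<phi> t)" using p\<phi>[OF \<phi> \<open>t \<in> ?T\<close>] by simp
    next
      fix x assume *: "x \<in> sym_inv (m + i) \<and> (\<forall>t\<in>?T. x t = Some (p \<phi> t))"
      then show "x \<in> ?X" by auto
      show "?r x = \<phi>" using * p\<phi>[OF \<phi>] by (intro extensionalityI[OF _ ext]) auto
    qed auto
    then have "(\<Sum>x | x \<in> ?X \<and> ?r x = \<phi>. ?w x)
        = (\<Sum>z\<in>sym_inv m. ?w (map_option (p \<phi>) \<circ> pad m i z))"
      using sum.reindex_bij_betw[OF bij_betw_pad_perm[OF p[OF \<phi>]], of ?w] by simp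
    then show "(\<Sum>x | x \<in> ?X \<and> ?r x = \<phi>. ?w x)
        = (\<Sum>z\<in>sym_inv m. w (map_option (p \<phi>) \<circ> pad m i (pmul g z)))"
      by (simp only: pmul_pad[OF g])
  qed
  finally show ?thesis .
qed

section \<open>The reduction to rank zero\<close>

lemma empty_in_sym_inv: "Map.empty \<in> sym_inv m"
  by (simp add: sym_inv_def)

lemma dom_pad_empty: "dom (pad m i Map.empty) = {m + 1..m + i}"
  by (auto simp: pad_def dom_def)

text \<open>In the last step nothing is left to absorb \<open>p \<phi>\<close>, so \<open>\<phi>\<close> must be the inclusion of the top
  points; each earlier step contributes one factor \<open>card (top_injections m i)\<close>.\<close>

lemma walk_prob_pad:
  assumes "g \<in> sym_inv m"
  shows "walk_prob (m + i) (Suc k) (pad m i g) (pad m i Map.empty) =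
           (real (card (sym_inv m)) / real (card (sym_inv (m + i)))) ^ Suc k
           * real (card (top_injections m i)) ^ k
           * walk_prob m (Suc k) g Map.empty"
proof -
  let ?T = "{m + 1..m + i}" and ?\<Phi> = "top_injections m i" and ?e = "pad m i Map.empty"
  let ?M = "real (card (sym_inv m))" and ?N = "real (card (sym_inv (m + i)))"
  have M: "?M \<noteq> 0" using sym_inv_nonempty finite_sym_inv by simp
  have "\<forall>\<phi>\<in>?\<Phi>. \<exists>p. p permutes {1..m + i} \<and> (\<forall>t\<in>?T. p t = \<phi> t)"
    by (rule ballI) (rule top_injection_extends_to_perm)
  from bchoice[OF this] obtain p
    where p: "\<And>\<phi>. \<phi> \<in> ?\<Phi> \<Longrightarrow> p \<phi> permutes {1..m + i}"
      and p\<phi>: "\<And>\<phi> t. \<phi> \<in> ?\<Phi> \<Longrightarrow> t \<in> ?T \<Longrightarrow> p \<phi> t = \<phi> t"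
    by blast
  have step: "walk_prob (m + i) (Suc k) (pad m i g) ?e
      = (\<Sum>\<phi>\<in>?\<Phi>. \<Sum>z\<in>sym_inv m.
          walk_prob (m + i) k (map_option (p \<phi>) \<circ> pad m i (pmul g z)) ?e) / ?N"
    if "g \<in> sym_inv m" for g k
  proof -
    have "walk_prob (m + i) k h ?e = 0" if "\<not> ?T \<subseteq> dom h" for h
      using that by (intro walk_prob_eq_0) (simp only: dom_pad_empty not_False_eq_True)
    then have "(\<Sum>x\<in>sym_inv (m + i). walk_prob (m + i) k (pmul (pad m i g) x) ?e)
      = (\<Sum>\<phi>\<in>?\<Phi>. \<Sum>z\<in>sym_inv m.
          walk_prob (m + i) k (map_option (p \<phi>) \<circ> pad m i (pmul g z)) ?e)"
      by (rule sum_over_defined_on_top[OF \<open>g \<in> sym_inv m\<close> _ p p\<phi>])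
    then show ?thesis by (simp only: walk_prob_Suc)
  qed
  show ?thesis
    using assms
  proof (induction k arbitrary: g)
    case 0
    let ?\<iota> = "\<lambda>t\<in>?T. t"
    have \<iota>: "?\<iota> \<in> ?\<Phi>" by (auto simp: top_injections_def inj_on_def)
    have fib: "map_option (p \<phi>) \<circ> pad m i h = ?e \<longleftrightarrow> \<phi> = ?\<iota> \<and> h = Map.empty"
      if \<phi>: "\<phi> \<in> ?\<Phi>" and h: "h \<in> sym_inv m" for \<phi> h
    proof
      assume eq: "map_option (p \<phi>) \<circ> pad m i h = ?e"
      have "\<phi> t = t" if "t \<in> ?T" for t
        using fun_cong[OF eq, of t] that p\<phi>[OF \<phi> that] by (simp add: pad_def)
      moreover have "\<phi> \<in> extensional ?T" using \<phi> by (auto simp: top_injections_def PiE_def)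
      ultimately have "\<phi> = ?\<iota>" by (intro extensionalityI) auto
      moreover have "h = Map.empty"
      proof
        fix x
        show "h x = None"
        proof (cases "x \<in> ?T")
          case True
          then show ?thesis using h by (auto simp: sym_inv_def)
        next
          case False
          then show ?thesis using fun_cong[OF eq, of x] by (simp add: pad_def split: if_splits)
        qed
      qed
      ultimately show "\<phi> = ?\<iota> \<and> h = Map.empty" ..
    next
      assume "\<phi> = ?\<iota> \<and> h = Map.empty"
      then show "map_option (p \<phi>) \<circ> pad m i h = ?e"
        using p\<phi>[OF \<phi>] by (auto simp: fun_eq_iff pad_def)
    qed
    have "walk_prob (m + i) (Suc 0) (pad m i g) ?e
        = (\<Sum>\<phi>\<in>?\<Phi>. \<Sum>z\<in>sym_inv m. of_bool (\<phi> = ?\<iota> \<and> pmul g z = Map.empty)) / ?N"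
      by (simp only: step[OF 0] walk_prob_0 fib pmul_in_sym_inv[OF 0] cong: sum.cong)
    also have "\<dots> = (\<Sum>\<phi>\<in>?\<Phi>. of_bool (\<phi> = ?\<iota>)
        * (\<Sum>z\<in>sym_inv m. of_bool (pmul g z = Map.empty))) / ?N"
      by (simp only: of_bool_conj sum_distrib_left)
    also have "\<dots> = (\<Sum>z\<in>sym_inv m. of_bool (pmul g z = Map.empty)) / ?N"
      using \<iota> finite_top_injections
      by (simp add: sum_distrib_right[symmetric] of_bool_def[of "_ = restrict _ _"] sum.delta)
    finally show ?case using M by (simp add: walk_prob_Suc[of m] walk_prob_0)
  next
    case (Suc k)
    have "walk_prob (m + i) (Suc (Suc k)) (pad m i g) ?e
        = (\<Sum>\<phi>\<in>?\<Phi>. \<Sum>z\<in>sym_inv m. walk_prob (m + i) (Suc k) (pad m i (pmul g z)) ?e) / ?N"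
      by (simp only: step[OF Suc.prems] walk_prob_perm[OF p] cong: sum.cong)
    also have "\<dots> = real (card ?\<Phi>) * (\<Sum>z\<in>sym_inv m. (?M / ?N) ^ Suc k * real (card ?\<Phi>) ^ k
        * walk_prob m (Suc k) (pmul g z) Map.empty) / ?N"
      by (simp only: Suc.IH[OF pmul_in_sym_inv[OF Suc.prems]] sum_constant cong: sum.cong)
    also have "\<dots> = real (card ?\<Phi>) * ((?M / ?N) ^ Suc k * real (card ?\<Phi>) ^ k
        * (?M * walk_prob m (Suc (Suc k)) g Map.empty)) / ?N"
      using M by (simp only: sum_distrib_left[symmetric] walk_prob_Suc[of m "Suc k"]) simp
    finally show ?case by simp
  qed
qed

theorem proposition8:
  fixes n k i :: nat
  assumes "0 < n" and "0 < k" and "i \<le> n"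
  shows "rank_prob k n i =
           (real (card (sym_inv (n - i))) / real (card (sym_inv n))) ^ k
           * falling_fact (real n) i ^ (k - 1)
           * rank_prob k (n - i) 0"
proof -
  define m where "m = n - i"
  have n: "n = m + i" using assms(3) by (simp add: m_def)
  obtain l where k: "k = Suc l" using assms(2) gr0_conv_Suc by blast
  let ?e = "pad m i Map.empty"
  have one: "Some |` {1..m} \<in> sym_inv m"
    by (auto simp: sym_inv_def ran_def restrict_map_def inj_on_def split: if_splits)
  have pad_one: "pad m i (Some |` {1..m}) = Some |` {1..m + i}"
    by (auto simp: pad_def restrict_map_def fun_eq_iff)
  have "rank_prob k n i = prob_product_eq k n ?e"
    using prob_product_eq_rank[OF assms(2) pad_in_sym_inv[OF empty_in_sym_inv], of m i]
    by (simp add: n map_rank_def dom_pad_empty)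
  moreover have "rank_prob k m 0 = prob_product_eq k m Map.empty"
    using prob_product_eq_rank[OF assms(2) empty_in_sym_inv, of m] by (simp add: map_rank_def)
  ultimately show ?thesis
    using walk_prob_pad[OF one, of i l, unfolded pad_one]
    by (simp add: n k prob_product_eq_walk_prob card_top_injections)
qed

end
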